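(* $Avg$ is convex, that is: if $I\subset\mathbb{R}$ is a closed interval, $H\in Dom(Avg)$ with $Avg(H)\in I$, $L\subset I$, and $H\cup L\in Dom(Avg)$, then $Avg(H\cup L)\in I$.
   Context: $\mu^s$ denotes the $s$-dimensional Hausdorff measure on $\mathbb{R}$ ($0\le s\le 1$). A set $H\subset\mathbb{R}$ is an $s$-set if it is $\mu^s$-measurable and $0<\mu^s(H)<+\infty$. For a bounded $s$-set $H$, $Avg(H)=\frac{\int_H x\,d\mu^s}{\mu^s(H)}$ (for a given $H$ there is at most one such $s$). $Dom(Avg)$ is the set of bounded subsets of $\mathbb{R}$ that are $s$-sets for some $0\le s\le 1$ (with $s$ depending on the set). *)

theory Defs
  imports "HOL-Analysis.Analysis"
begin

(* The s-th power of the diameter, with the conventions |{}|^s = 0 for every s, and |U|^0 = 1 for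
   every nonempty U.  The latter needs a separate case, as 0 powr 0 = 0 while singletons have
   diameter 0; with it, the measure obtained for s = 0 is the counting measure. *)
definition diam_pow :: "real \<Rightarrow> real set \<Rightarrow> ennreal" where
  "diam_pow s U = (if U = {} then 0 else if s = 0 then 1 else ennreal (diameter U powr s))"

(* Boundedness is required because diameter is unspecified on unbounded sets.  Finite covers are
   included, by padding with empty sets. *)
definition delta_covers :: "real \<Rightarrow> real set \<Rightarrow> (nat \<Rightarrow> real set) set" where
  "delta_covers \<delta> A = {U. A \<subseteq> (\<Union>i. U i) \<and> (\<forall>i. bounded (U i) \<and> diameter (U i) \<le> \<delta>)}"

definition hausdorff_premeasure :: "real \<Rightarrow> real \<Rightarrow> real set \<Rightarrow> ennreal" where
  "hausdorff_premeasure s \<delta> A = (INF U\<in>delta_covers \<delta> A. \<Sum>i. diam_pow s (U i))"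

(* The limit for \<delta> tending to 0 is a supremum, by monotonicity. No normalising constant is used. *)
definition hausdorff_outer :: "real \<Rightarrow> real set \<Rightarrow> ennreal" where
  "hausdorff_outer s A = (SUP \<delta>\<in>{0<..}. hausdorff_premeasure s \<delta> A)"

(* lambda_system UNIV UNIV f is the set of all sets that are Caratheodory measurable for the
   outer measure f. *)
definition hausdorff_measure :: "real \<Rightarrow> real measure" where
  "hausdorff_measure s =
     measure_of UNIV (lambda_system UNIV UNIV (hausdorff_outer s)) (hausdorff_outer s)"

definition s_set :: "real \<Rightarrow> real set \<Rightarrow> bool" where
  "s_set s H \<longleftrightarrow> H \<in> sets (hausdorff_measure s) \<and>
     0 < emeasure (hausdorff_measure s) H \<and> emeasure (hausdorff_measure s) H < \<infinity>"

definition Dom_Avg :: "real set set" where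
  "Dom_Avg = {H. bounded H \<and> (\<exists>s. 0 \<le> s \<and> s \<le> 1 \<and> s_set s H)}"

definition set_dim :: "real set \<Rightarrow> real" where
  "set_dim H = (THE s. 0 \<le> s \<and> s \<le> 1 \<and> s_set s H)"

definition Avg :: "real set \<Rightarrow> real" where
  "Avg H = (LINT x:H|hausdorff_measure (set_dim H). x) / measure (hausdorff_measure (set_dim H)) H"


(* measure_of yields the zero measure unless its arguments form a measure space; the rest of this
   theory shows that they do, so that hausdorff_measure is the intended measure. *)

lemma hausdorff_premeasure_mono:
  "A \<subseteq> B \<Longrightarrow> hausdorff_premeasure s \<delta> A \<le> hausdorff_premeasure s \<delta> B"
  unfolding hausdorff_premeasure_def
  by (rule INF_superset_mono) (auto simp: delta_covers_def)

lemma hausdorff_premeasure_empty: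
  assumes "0 \<le> \<delta>"
  shows "hausdorff_premeasure s \<delta> {} = 0"
proof -
  have "hausdorff_premeasure s \<delta> {} \<le> (\<Sum>i. diam_pow s ((\<lambda>i::nat. {}) i))"
    unfolding hausdorff_premeasure_def
    by (rule INF_lower) (use assms in \<open>auto simp: delta_covers_def\<close>)
  then show ?thesis by (simp add: diam_pow_def)
qed

lemma hausdorff_premeasure_countably_subadditive:
  "hausdorff_premeasure s \<delta> (\<Union>i. A i) \<le> (\<Sum>i. hausdorff_premeasure s \<delta> (A i))"
proof (rule ennreal_le_epsilon)
  let ?O = "hausdorff_premeasure s \<delta>"
  fix e :: real
  assume e: "0 < e" and "(\<Sum>n. ?O (A n)) < top"
  then have *: "?O (A n) < ?O (A n) + ennreal e * ennreal ((1/2) ^ Suc n)" for n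
    by (auto simp: less_top dest!: ennreal_suminf_lessD
        simp flip: ennreal_mult intro!: ennreal_zero_less_mult_iff)
  have "\<exists>U\<in>delta_covers \<delta> (A n).
      (\<Sum>i. diam_pow s (U i)) < ?O (A n) + ennreal e * ennreal ((1/2) ^ Suc n)" for n
    using *[of n] unfolding hausdorff_premeasure_def INF_less_iff .
  then obtain U where U: "\<And>n. U n \<in> delta_covers \<delta> (A n)"
    and Ule: "\<And>n. (\<Sum>i. diam_pow s (U n i)) \<le> ?O (A n) + ennreal e * ennreal ((1/2) ^ Suc n)"
    by (metis less_imp_le)
  define C where "C = case_prod U \<circ> prod_decode"
  have "x \<in> (\<Union>i. C i)" if x: "x \<in> (\<Union>i. A i)" for x
  proof -
    obtain n where "x \<in> A n" using x by blast
    then obtain i where "x \<in> U n i" using U[of n] by (auto simp: delta_covers_def)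
    then have "x \<in> C (prod_encode (n, i))" by (simp add: C_def)
    then show ?thesis by blast
  qed
  moreover have "bounded (C i) \<and> diameter (C i) \<le> \<delta>" for i
    using U by (simp add: delta_covers_def C_def case_prod_beta)
  ultimately have "C \<in> delta_covers \<delta> (\<Union>i. A i)"
    unfolding delta_covers_def by blast
  then have "?O (\<Union>i. A i) \<le> (\<Sum>i. diam_pow s (C i))"
    unfolding hausdorff_premeasure_def by (rule INF_lower)
  also have "\<dots> = (\<Sum>n. \<Sum>i. diam_pow s (U n i))"
    using suminf_ennreal_2dimen[of "\<lambda>n. \<Sum>i. diam_pow s (U n i)" "\<lambda>(n, i). diam_pow s (U n i)"]
    by (simp add: C_def case_prod_beta)
  also have "\<dots> \<le> (\<Sum>n. ?O (A n) + ennreal e * ennreal ((1/2) ^ Suc n))"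
    by (intro suminf_le allI Ule) auto
  also have "\<dots> = (\<Sum>n. ?O (A n)) + (\<Sum>n. ennreal e * ennreal ((1/2) ^ Suc n))"
    by (subst suminf_add[symmetric]) auto
  also have "\<dots> = (\<Sum>n. ?O (A n)) + e"
    unfolding ennreal_suminf_cmult
    by (subst suminf_ennreal_eq[OF zero_le_power power_half_series]) auto
  finally show "?O (\<Union>i. A i) \<le> (\<Sum>n. ?O (A n)) + e" .
qed

lemma outer_measure_space_hausdorff: "outer_measure_space UNIV (hausdorff_outer s)"
  unfolding outer_measure_space_def
proof (intro conjI)
  show "positive UNIV (hausdorff_outer s)"
    by (simp add: positive_def hausdorff_outer_def hausdorff_premeasure_empty)
  show "increasing UNIV (hausdorff_outer s)"
    by (auto simp: increasing_def hausdorff_outer_def intro!: SUP_mono' hausdorff_premeasure_mono)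
  show "countably_subadditive UNIV (hausdorff_outer s)"
    unfolding countably_subadditive_def
  proof (intro allI impI)
    fix A :: "nat \<Rightarrow> real set"
    show "hausdorff_outer s (\<Union>i. A i) \<le> (\<Sum>i. hausdorff_outer s (A i))"
      unfolding hausdorff_outer_def[of s "\<Union>i. A i"]
    proof (rule SUP_least)
      fix \<delta> :: real
      assume "\<delta> \<in> {0<..}"
      then have "(\<Sum>i. hausdorff_premeasure s \<delta> (A i)) \<le> (\<Sum>i. hausdorff_outer s (A i))"
        unfolding hausdorff_outer_def by (intro suminf_le SUP_upper) auto
      then show "hausdorff_premeasure s \<delta> (\<Union>i. A i) \<le> (\<Sum>i. hausdorff_outer s (A i))"
        using hausdorff_premeasure_countably_subadditive order_trans by blast
    qed
  qed
qed

lemma measure_space_hausdorff: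
  "measure_space UNIV (lambda_system UNIV UNIV (hausdorff_outer s)) (hausdorff_outer s)"
  using sigma_algebra.caratheodory_lemma[OF sigma_algebra_Pow[of UNIV]]
    outer_measure_space_hausdorff[of s] by simp

lemma space_hausdorff_measure: "space (hausdorff_measure s) = UNIV"
  by (simp add: hausdorff_measure_def)

lemma sets_hausdorff_measure:
  "sets (hausdorff_measure s) = lambda_system UNIV UNIV (hausdorff_outer s)"
  using measure_space_hausdorff[of s]
  by (simp add: hausdorff_measure_def measure_space_def sigma_algebra.sigma_sets_eq)

lemma emeasure_hausdorff_measure:
  assumes "A \<in> sets (hausdorff_measure s)"
  shows "emeasure (hausdorff_measure s) A = hausdorff_outer s A"
proof (rule emeasure_measure_of[OF hausdorff_measure_def])
  show "positive (sets (hausdorff_measure s)) (hausdorff_outer s)"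
    and "countably_additive (sets (hausdorff_measure s)) (hausdorff_outer s)"
    using measure_space_hausdorff[of s] by (auto simp: sets_hausdorff_measure measure_space_def)
qed (use assms in auto)

end

theory Submission
  imports Defs
begin

text \<open>Let \<open>K = H \<union> L\<close>, and let \<open>s\<close>, \<open>t\<close> be the dimensions of \<open>H\<close> and \<open>K\<close>. If \<open>c = Avg K\<close> is not in \<open>I\<close>, then
  \<open>x - c\<close> has a constant strict sign on \<open>I\<close>, while its integral over \<open>K\<close> vanishes. For \<open>s = t\<close> the
  integral over \<open>H\<close> is a positive multiple of \<open>Avg H - c\<close> and the integral over \<open>K - H\<close>, a subset of
  \<open>I\<close>, has the same sign. For \<open>s < t\<close> the set \<open>H\<close> is null, so \<open>K\<close> lies in \<open>I\<close> up to a null set. The case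
  \<open>t < s\<close> is impossible, because \<open>H\<close> would then have measure zero.\<close>

section \<open>Comparison of Hausdorff measures of different dimensions\<close>

text \<open>Split \<open>d powr t\<close> as \<open>d powr (t - s) * d powr s\<close> and bound the
  first factor. Diameter 0 is treated apart: there \<open>0 < t\<close> makes the left side 0,
  whatever the convention for \<open>s = 0\<close> puts on the right.\<close>

lemma diam_pow_mono_exponent:
  assumes "0 \<le> s" "s < t" "bounded U" "diameter U \<le> \<delta>" "0 < \<delta>"
  shows "diam_pow t U \<le> ennreal (\<delta> powr (t - s)) * diam_pow s U"
proof (cases "U = {} \<or> diameter U = 0")
  case True
  then show ?thesis using assms by (auto simp: diam_pow_def)
next
  case False
  then have d: "0 < diameter U" using diameter_ge_0[OF assms(3)] by simp
  have "diameter U powr t = diameter U powr (t - s) * diameter U powr s"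
    by (simp flip: powr_add)
  also have "\<dots> \<le> \<delta> powr (t - s) * diameter U powr s"
    using d assms by (intro mult_right_mono powr_mono2) auto
  finally have "ennreal (diameter U powr t) \<le> ennreal (\<delta> powr (t - s) * diameter U powr s)"
    by (rule ennreal_leI)
  then show ?thesis using False d assms
    by (auto simp: diam_pow_def ennreal_mult)
qed

lemma hausdorff_premeasure_le_outer:
  "0 < \<delta> \<Longrightarrow> hausdorff_premeasure s \<delta> A \<le> hausdorff_outer s A"
  unfolding hausdorff_outer_def by (rule SUP_upper) simp

lemma hausdorff_premeasure_antimono:
  "\<delta> \<le> \<delta>' \<Longrightarrow> hausdorff_premeasure s \<delta>' A \<le> hausdorff_premeasure s \<delta> A"
  unfolding hausdorff_premeasure_def
  by (rule INF_superset_mono) (auto simp: delta_covers_def intro: order_trans)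

lemma hausdorff_outer_mono: "A \<subseteq> B \<Longrightarrow> hausdorff_outer s A \<le> hausdorff_outer s B"
  unfolding hausdorff_outer_def by (auto intro!: SUP_mono' hausdorff_premeasure_mono)

lemma hausdorff_outer_Un_le:
  "hausdorff_outer s (A \<union> B) \<le> hausdorff_outer s A + hausdorff_outer s B"
proof -
  interpret ring_of_sets UNIV "UNIV :: real set set"
    by (rule ring_of_setsI) auto
  have "subadditive UNIV (hausdorff_outer s)"
    using outer_measure_space_hausdorff[of s]
    by (intro countably_subadditive_subadditive) (auto simp: outer_measure_space_def)
  \<comment> \<open>\<open>subadditive\<close> speaks of disjoint sets only, hence
    \<open>B - A\<close>.\<close>
  then have "hausdorff_outer s (A \<union> (B - A)) \<le> hausdorff_outer s A + hausdorff_outer s (B - A)"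
    by (rule subadditiveD) auto
  also have "\<dots> \<le> hausdorff_outer s A + hausdorff_outer s B"
    by (intro add_left_mono hausdorff_outer_mono) auto
  finally show ?thesis by simp
qed

text \<open>A fine cover with bounded \<open>s\<close>-sum has a \<open>t\<close>-sum smaller by a
  factor \<open>\<delta> powr (t - s)\<close>, which tends to 0 with
  \<open>\<delta>\<close>.\<close>

lemma hausdorff_outer_eq_0:
  assumes "0 \<le> s" "s < t" "hausdorff_outer s A < \<infinity>"
  shows "hausdorff_outer t A = 0"
proof -
  \<comment> \<open>Adding 1 makes the bound strict, so that some actual cover stays below
    it.\<close>
  let ?m = "hausdorff_outer s A + 1"
  have bound: "hausdorff_premeasure t \<delta> A \<le> ennreal (\<delta> powr (t - s)) * ?m" if "0 < \<delta>" for \<delta>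
  proof -
    have "hausdorff_premeasure s \<delta> A \<le> hausdorff_outer s A"
      using that by (rule hausdorff_premeasure_le_outer)
    also have "\<dots> < ?m"
      using assms(3) by (simp add: ennreal_add_left_cancel_less[of _ 0 1, simplified])
    finally obtain U where U: "U \<in> delta_covers \<delta> A" "(\<Sum>i. diam_pow s (U i)) < ?m"
      unfolding hausdorff_premeasure_def INF_less_iff by blast
    have "hausdorff_premeasure t \<delta> A \<le> (\<Sum>i. diam_pow t (U i))"
      unfolding hausdorff_premeasure_def using U(1) by (rule INF_lower)
    also have "\<dots> \<le> (\<Sum>i. ennreal (\<delta> powr (t - s)) * diam_pow s (U i))"
      using U assms that
      by (intro suminf_le allI diam_pow_mono_exponent) (auto simp: delta_covers_def)
    also have "\<dots> \<le> ennreal (\<delta> powr (t - s)) * ?m"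
      using U(2) by (simp add: mult_left_mono less_imp_le)
    finally show ?thesis .
  qed
  \<comment> \<open>For \<open>e < \<delta>\<close> the premeasure at \<open>\<delta>\<close> is at
    most the one at \<open>e\<close>, so the bound at \<open>e\<close> applies; then
    \<open>e\<close> tends to 0.\<close>
  have "hausdorff_premeasure t \<delta> A \<le> 0" if "0 < \<delta>" for \<delta>
  proof (rule tendsto_lowerbound)
    have "((\<lambda>e. e powr (t - s)) \<longlongrightarrow> 0) (at_right 0)"
      using assms by (auto intro!: tendsto_eq_intros simp: eventually_at_right_less eventually_at_filter)
    then have "((\<lambda>e. ennreal (e powr (t - s)) * ?m) \<longlongrightarrow> ennreal 0 * ?m) (at_right 0)"
      using assms by (intro tendsto_mult_ennreal tendsto_ennrealI) auto
    then show "((\<lambda>e. ennreal (e powr (t - s)) * ?m) \<longlongrightarrow> 0) (at_right 0)" by simp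
    show "\<forall>\<^sub>F e in at_right 0. hausdorff_premeasure t \<delta> A \<le> ennreal (e powr (t - s)) * ?m"
      using eventually_at_right_less[of 0] eventually_at_right_real[OF that]
      by eventually_elim (auto intro: order_trans[OF hausdorff_premeasure_antimono bound])
  qed simp
  then show ?thesis
    by (auto simp: hausdorff_outer_def SUP_eq_iff bot_ennreal)
qed

section \<open>Caratheodory measurability, and half-lines in positive dimension\<close>

text \<open>The other half of the Caratheodory equation is subadditivity.\<close>

lemma sets_hausdorff_measureI:
  assumes "\<And>E. hausdorff_outer s (E \<inter> A) + hausdorff_outer s (E - A) \<le> hausdorff_outer s E"
  shows "A \<in> sets (hausdorff_measure s)"
proof -
  have "hausdorff_outer s (A \<inter> E) + hausdorff_outer s ((UNIV - A) \<inter> E) = hausdorff_outer s E" for E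
  proof (rule antisym)
    show "hausdorff_outer s (A \<inter> E) + hausdorff_outer s ((UNIV - A) \<inter> E) \<le> hausdorff_outer s E"
      using assms[of E] by (simp add: Int_commute Diff_eq)
    show "hausdorff_outer s E \<le> hausdorff_outer s (A \<inter> E) + hausdorff_outer s ((UNIV - A) \<inter> E)"
      using hausdorff_outer_Un_le[of s "A \<inter> E" "(UNIV - A) \<inter> E"]
      by (simp flip: Int_Un_distrib2)
  qed
  then show ?thesis by (auto simp: sets_hausdorff_measure lambda_system_def)
qed

text \<open>For \<open>s < t\<close>, the set \<open>H\<close> is given as measurable in dimension
  \<open>s\<close> only; this lemma makes it measurable, and null, in dimension
  \<open>t\<close>.\<close>

lemma null_sets_hausdorff_measureI:
  assumes "hausdorff_outer s A = 0"
  shows "A \<in> null_sets (hausdorff_measure s)"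
proof -
  have "hausdorff_outer s (E \<inter> A) = 0" for E
    using hausdorff_outer_mono[of "E \<inter> A" A s] assms by simp
  then have "A \<in> sets (hausdorff_measure s)"
    by (intro sets_hausdorff_measureI) (simp add: hausdorff_outer_mono)
  with assms show ?thesis by (simp add: null_sets_def emeasure_hausdorff_measure)
qed

text \<open>A set of the cover that meets both sides of \<open>a\<close> lies in \<open>{a - \<delta>..a + \<delta>}\<close>; all of these are
  replaced at once by two intervals of length \<open>\<delta>\<close>.\<close>

lemma hausdorff_premeasure_cut:
  assumes "0 < \<delta>" "0 < s"
  shows "hausdorff_premeasure s \<delta> (E \<inter> {..a}) + hausdorff_premeasure s \<delta> (E - {..a})
    \<le> hausdorff_premeasure s \<delta> E + ennreal (2 * \<delta> powr s)"
proof -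
  have "hausdorff_premeasure s \<delta> (E \<inter> {..a}) + hausdorff_premeasure s \<delta> (E - {..a})
      \<le> (\<Sum>i. diam_pow s (U i)) + ennreal (2 * \<delta> powr s)" if U: "U \<in> delta_covers \<delta> E" for U
  proof -
    \<comment> \<open>Index 0 holds the new interval and the old cover is shifted by one. Sets that
      meet both sides of \<open>a\<close> become empty in both \<open>V\<close> and
      \<open>W\<close>.\<close>
    define V where "V = case_nat {a - \<delta>..a} (\<lambda>i. if U i \<subseteq> {..a} then U i else {})"
    define W where "W = case_nat {a..a + \<delta>} (\<lambda>i. if U i \<subseteq> {a<..} then U i else {})"
    have bd: "bounded (U i)" "diameter (U i) \<le> \<delta>" for i
      using U by (auto simp: delta_covers_def)
    have dist: "\<bar>x - y\<bar> \<le> \<delta>" if "x \<in> U i" "y \<in> U i" for x y i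
      using diameter_bounded_bound[OF bd(1) that] bd(2)[of i] by (simp add: dist_real_def)
    have "E \<inter> {..a} \<subseteq> (\<Union>i. V i)"
    proof
      fix x assume x: "x \<in> E \<inter> {..a}"
      then obtain i where i: "x \<in> U i" using U by (auto simp: delta_covers_def)
      show "x \<in> (\<Union>i. V i)"
      proof (cases "U i \<subseteq> {..a}")
        case True
        then have "x \<in> V (Suc i)" using i by (simp add: V_def)
        then show ?thesis by blast
      next
        case False
        then obtain y where "y \<in> U i" "a < y" by (auto simp: subset_iff not_le)
        then have "x \<in> V 0" using dist[OF i, of y] x by (auto simp: V_def)
        then show ?thesis by blast
      qed
    qed
    moreover have "bounded (V i) \<and> diameter (V i) \<le> \<delta>" for i
      using assms bd by (auto simp: V_def diameter_closed_interval split: nat.split)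
    ultimately have V: "V \<in> delta_covers \<delta> (E \<inter> {..a})" by (simp add: delta_covers_def)
    have "E - {..a} \<subseteq> (\<Union>i. W i)"
    proof
      fix x assume x: "x \<in> E - {..a}"
      then obtain i where i: "x \<in> U i" using U by (auto simp: delta_covers_def)
      show "x \<in> (\<Union>i. W i)"
      proof (cases "U i \<subseteq> {a<..}")
        case True
        then have "x \<in> W (Suc i)" using i by (simp add: W_def)
        then show ?thesis by blast
      next
        case False
        then obtain y where "y \<in> U i" "y \<le> a" by (auto simp: subset_iff not_less)
        then have "x \<in> W 0" using dist[OF i, of y] x by (auto simp: W_def)
        then show ?thesis by blast
      qed
    qed
    moreover have "bounded (W i) \<and> diameter (W i) \<le> \<delta>" for i
      using assms bd by (auto simp: W_def diameter_closed_interval split: nat.split)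
    ultimately have W: "W \<in> delta_covers \<delta> (E - {..a})" by (simp add: delta_covers_def)
    have head: "(\<Sum>i. f i) = (\<Sum>i. f (Suc i)) + f 0" for f :: "nat \<Rightarrow> ennreal"
      by (intro sums_unique[symmetric] sums_Suc summable_sums) simp
    have "(\<Sum>i. diam_pow s (V i)) + (\<Sum>i. diam_pow s (W i))
        = ((\<Sum>i. diam_pow s (V (Suc i))) + (\<Sum>i. diam_pow s (W (Suc i))))
          + (diam_pow s (V 0) + diam_pow s (W 0))"
      by (simp add: head[of "\<lambda>i. diam_pow s (V i)"] head[of "\<lambda>i. diam_pow s (W i)"] ac_simps)
    also have "(\<Sum>i. diam_pow s (V (Suc i))) + (\<Sum>i. diam_pow s (W (Suc i)))
        = (\<Sum>i. diam_pow s (V (Suc i)) + diam_pow s (W (Suc i)))"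
      by (intro suminf_add) auto
    also have "\<dots> \<le> (\<Sum>i. diam_pow s (U i))"
    proof (intro suminf_le allI)
      fix i
      \<comment> \<open>No nonempty \<open>U i\<close> survives in both covers, so the two terms
        together cost at most \<open>diam_pow s (U i)\<close>.\<close>
      have "U i = {}" if "U i \<subseteq> {..a}" "U i \<subseteq> {a<..}" using that by fastforce
      then show "diam_pow s (V (Suc i)) + diam_pow s (W (Suc i)) \<le> diam_pow s (U i)"
        by (auto simp: V_def W_def diam_pow_def)
    qed auto
    also have "diam_pow s (V 0) + diam_pow s (W 0) = ennreal (2 * \<delta> powr s)"
      using assms by (simp add: V_def W_def diam_pow_def diameter_closed_interval flip: ennreal_plus)
    finally have "(\<Sum>i. diam_pow s (V i)) + (\<Sum>i. diam_pow s (W i))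
        \<le> (\<Sum>i. diam_pow s (U i)) + ennreal (2 * \<delta> powr s)" by simp
    moreover have "hausdorff_premeasure s \<delta> (E \<inter> {..a}) \<le> (\<Sum>i. diam_pow s (V i))"
      unfolding hausdorff_premeasure_def using V by (rule INF_lower)
    moreover have "hausdorff_premeasure s \<delta> (E - {..a}) \<le> (\<Sum>i. diam_pow s (W i))"
      unfolding hausdorff_premeasure_def using W by (rule INF_lower)
    ultimately show ?thesis by (meson add_mono order_trans)
  qed
  \<comment> \<open>The error term moves to the left so that the right side is exactly the infimum
    over covers.\<close>
  then have "hausdorff_premeasure s \<delta> (E \<inter> {..a}) + hausdorff_premeasure s \<delta> (E - {..a})
      - ennreal (2 * \<delta> powr s) \<le> hausdorff_premeasure s \<delta> E"
    unfolding hausdorff_premeasure_def[of s \<delta> E]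
    by (intro INF_greatest) (simp add: ennreal_minus_le_iff add.commute)
  then show ?thesis by (simp add: ennreal_minus_le_iff add.commute)
qed

text \<open>The error \<open>2 * \<delta> powr s\<close> of the cut vanishes as
  \<open>\<delta>\<close> tends to 0, because \<open>0 < s\<close>.\<close>

lemma atMost_in_sets_hausdorff_measure_pos:
  assumes "0 < s"
  shows "{..a} \<in> sets (hausdorff_measure s)"
proof (rule sets_hausdorff_measureI)
  fix E :: "real set"
  let ?A = "E \<inter> {..a}" and ?B = "E - {..a}"
  have pre: "hausdorff_premeasure s \<delta> ?A + hausdorff_premeasure s \<delta> ?B \<le> hausdorff_outer s E"
    if "0 < \<delta>" for \<delta>
  proof (rule ennreal_le_epsilon)
    fix e :: real assume "0 < e"
    \<comment> \<open>Small enough for an error of at most \<open>e\<close>, and at most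
      \<open>\<delta>\<close>, so that the premeasures at \<open>\<eta>\<close> dominate those at
      \<open>\<delta>\<close>.\<close>
    define \<eta> where "\<eta> = min \<delta> ((e / 2) powr (1 / s))"
    have \<eta>: "0 < \<eta>" "\<eta> \<le> \<delta>" using that \<open>0 < e\<close> by (auto simp: \<eta>_def)
    have "\<eta> powr s \<le> ((e / 2) powr (1 / s)) powr s"
      using \<eta> assms by (intro powr_mono2) (auto simp: \<eta>_def)
    then have "2 * \<eta> powr s \<le> e" using assms \<open>0 < e\<close> by (simp add: powr_powr)
    have "hausdorff_premeasure s \<delta> ?A + hausdorff_premeasure s \<delta> ?B
        \<le> hausdorff_premeasure s \<eta> ?A + hausdorff_premeasure s \<eta> ?B"
      using \<eta> by (intro add_mono hausdorff_premeasure_antimono)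
    also have "\<dots> \<le> hausdorff_premeasure s \<eta> E + ennreal (2 * \<eta> powr s)"
      using \<eta> assms by (intro hausdorff_premeasure_cut)
    also have "\<dots> \<le> hausdorff_outer s E + ennreal e"
      using \<eta> \<open>2 * \<eta> powr s \<le> e\<close>
      by (intro add_mono hausdorff_premeasure_le_outer ennreal_leI)
    finally show "hausdorff_premeasure s \<delta> ?A + hausdorff_premeasure s \<delta> ?B
        \<le> hausdorff_outer s E + ennreal e" .
  qed
  \<comment> \<open>The sum of the two suprema is a supremum over a common \<open>\<delta>\<close>,
    since the premeasures grow as \<open>\<delta>\<close> shrinks.\<close>
  have "hausdorff_outer s ?A + hausdorff_outer s ?B
      = (SUP \<delta>\<in>{0<..}. hausdorff_premeasure s \<delta> ?A + hausdorff_premeasure s \<delta> ?B)"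
    unfolding hausdorff_outer_def
  proof (rule SUP_add_directed_ennreal[symmetric])
    fix i j :: real assume "i \<in> {0<..}" "j \<in> {0<..}"
    then show "\<exists>k\<in>{0<..}. hausdorff_premeasure s i ?A + hausdorff_premeasure s j ?B
        \<le> hausdorff_premeasure s k ?A + hausdorff_premeasure s k ?B"
      by (intro bexI[of _ "min i j"] add_mono hausdorff_premeasure_antimono) auto
  qed
  also have "\<dots> \<le> hausdorff_outer s E" using pre by (intro SUP_least) auto
  finally show "hausdorff_outer s ?A + hausdorff_outer s ?B \<le> hausdorff_outer s E" .
qed

section \<open>Dimension zero as counting measure\<close>

text \<open>Once \<open>\<delta>\<close> is below all gaps of \<open>F\<close>, each set of a cover
  contains at most one point of \<open>F\<close>, so at least \<open>card F\<close> nonempty sets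
  occur, each counting 1.\<close>

lemma card_le_hausdorff_outer_0:
  assumes "finite F" "F \<subseteq> A"
  shows "of_nat (card F) \<le> hausdorff_outer 0 A"
proof -
  obtain e where e: "0 < e" "\<And>x y. x \<in> F \<Longrightarrow> y \<in> F \<Longrightarrow> x \<noteq> y \<Longrightarrow> e \<le> dist x y"
    using uniform_discrete_finite_iff[of F] assms(1)
    unfolding uniform_discrete_def by (metis not_less)
  \<comment> \<open>Halving turns the weak lower bound on distances into a strict one.\<close>
  define \<delta> where "\<delta> = e / 2"
  have \<delta>: "0 < \<delta>" "\<And>x y. x \<in> F \<Longrightarrow> y \<in> F \<Longrightarrow> x \<noteq> y \<Longrightarrow> \<delta> < dist x y"
    using e by (force simp: \<delta>_def)+
  have "of_nat (card F) \<le> (\<Sum>i. diam_pow 0 (U i))" if U: "U \<in> delta_covers \<delta> A" for U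
  proof -
    have "\<forall>x\<in>F. \<exists>i. x \<in> U i" using U assms by (auto simp: delta_covers_def)
    then obtain k where k: "\<And>x. x \<in> F \<Longrightarrow> x \<in> U (k x)" by metis
    have "inj_on k F"
    proof (rule inj_onI, rule ccontr)
      fix x y assume xy: "x \<in> F" "y \<in> F" "k x = k y" "x \<noteq> y"
      then have "dist x y \<le> diameter (U (k x))"
        using U k[of x] k[of y] by (intro diameter_bounded_bound) (auto simp: delta_covers_def)
      also have "\<dots> \<le> \<delta>" using U by (auto simp: delta_covers_def)
      finally show False using \<delta>(2)[of x y] xy by simp
    qed
    then have "of_nat (card F) = (\<Sum>i\<in>k ` F. 1 :: ennreal)" by (simp add: card_image)
    also have "\<dots> \<le> (\<Sum>i\<in>k ` F. diam_pow 0 (U i))"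
      using k by (intro sum_mono) (auto simp: diam_pow_def)
    also have "\<dots> \<le> (\<Sum>i. diam_pow 0 (U i))"
      using assms by (intro sum_le_suminf) auto
    finally show ?thesis .
  qed
  then have "of_nat (card F) \<le> hausdorff_premeasure 0 \<delta> A"
    unfolding hausdorff_premeasure_def by (rule INF_greatest)
  then show ?thesis using hausdorff_premeasure_le_outer[OF \<delta>(1)] order_trans by blast
qed

lemma hausdorff_outer_0_le_card:
  assumes "finite A"
  shows "hausdorff_outer 0 A \<le> of_nat (card A)"
  using assms
proof induction
  case empty
  then show ?case by (simp add: hausdorff_outer_def hausdorff_premeasure_empty)
next
  case (insert x A)
  have "hausdorff_outer 0 {x} \<le> 1"
    unfolding hausdorff_outer_def
  proof (rule SUP_least)
    fix \<delta> :: real assume "\<delta> \<in> {0<..}"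
    then have "hausdorff_premeasure 0 \<delta> {x} \<le> (\<Sum>i::nat. diam_pow 0 (if i = 0 then {x} else {}))"
      unfolding hausdorff_premeasure_def
      by (intro INF_lower) (auto simp: delta_covers_def)
    also have "\<dots> = (\<Sum>i\<in>{0}. diam_pow 0 (if i = (0::nat) then {x} else {}))"
      by (rule suminf_finite) (auto simp: diam_pow_def)
    finally show "hausdorff_premeasure 0 \<delta> {x} \<le> 1" by (simp add: diam_pow_def)
  qed
  with insert show ?case
    using hausdorff_outer_Un_le[of 0 "{x}" A] by (auto intro: order_trans add_mono)
qed

text \<open>In dimension 0 the two extra intervals of the cut would cost 2 at every scale.
  Half-lines are measurable there because the counting measure is additive on all sets.\<close>

lemma hausdorff_outer_0: "hausdorff_outer 0 A = emeasure (count_space UNIV) A"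
proof (cases "finite A")
  case True
  then show ?thesis
    using hausdorff_outer_0_le_card[OF True] card_le_hausdorff_outer_0[OF True order_refl]
    by simp
next
  case False
  have "of_nat n \<le> hausdorff_outer 0 A" for n
    using infinite_arbitrarily_large[OF False, of n] card_le_hausdorff_outer_0 by metis
  then have "hausdorff_outer 0 A = \<infinity>"
    by (metis ennreal_Ex_less_of_nat infinity_ennreal_def leD top.not_eq_extremum)
  then show ?thesis using False by simp
qed

lemma atMost_in_sets_hausdorff_measure:
  assumes "0 \<le> s"
  shows "{..a} \<in> sets (hausdorff_measure s)"
proof (cases "s = 0")
  case True
  have "emeasure (count_space UNIV) (E \<inter> {..a}) + emeasure (count_space UNIV) (E - {..a})
      = emeasure (count_space UNIV) E" for E :: "real set"
    by (subst plus_emeasure) (auto simp: Int_Diff_Un)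
  then show ?thesis using True by (auto intro!: sets_hausdorff_measureI simp: hausdorff_outer_0)
next
  case False
  then show ?thesis using assms by (intro atMost_in_sets_hausdorff_measure_pos) simp
qed

section \<open>Integrals over s-sets and the average\<close>

lemma borel_measurable_hausdorff_measure_ident:
  "0 \<le> s \<Longrightarrow> (\<lambda>x. x) \<in> borel_measurable (hausdorff_measure s)"
  using atMost_in_sets_hausdorff_measure
  by (auto simp: borel_measurable_iff_le space_hausdorff_measure atMost_def)

lemma s_set_outer:
  assumes "s_set s H"
  shows "0 < hausdorff_outer s H" "hausdorff_outer s H < \<infinity>"
  using assms by (auto simp: s_set_def emeasure_hausdorff_measure)

text \<open>Finite measure in the smaller dimension would force measure zero in the larger
  one.\<close>

lemma s_set_unique:
  assumes "0 \<le> s" "s_set s H" "0 \<le> t" "s_set t H"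
  shows "s = t"
  using assms hausdorff_outer_eq_0[of s t H] hausdorff_outer_eq_0[of t s H] s_set_outer[of s H]
    s_set_outer[of t H] by (cases s t rule: linorder_cases) auto

lemma set_dim_eq:
  assumes "0 \<le> s" "s \<le> 1" "s_set s H"
  shows "set_dim H = s"
  unfolding set_dim_def using assms by (intro the_equality) (auto dest: s_set_unique)

text \<open>The integrand is bounded on a set of finite measure. The factor \<open>\<sigma>\<close>
  will be 1 or -1, to treat both sides of \<open>c\<close> at once.\<close>

lemma s_set_integrable:
  assumes "0 \<le> s" "s_set s H" "bounded H"
  shows "set_integrable (hausdorff_measure s) H (\<lambda>x. \<sigma> * (x - c))"
proof -
  let ?M = "hausdorff_measure s"
  have [measurable]: "(\<lambda>x. x) \<in> borel_measurable ?M"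
    using assms by (intro borel_measurable_hausdorff_measure_ident)
  have [measurable]: "H \<in> sets ?M" and fin: "emeasure ?M H < \<infinity>"
    using assms by (auto simp: s_set_def)
  have "set_integrable ?M H (\<lambda>x. c)" for c
    unfolding set_integrable_def using fin by simp
  moreover have "set_integrable ?M H (\<lambda>x. x)"
  proof -
    obtain B where "\<And>x. x \<in> H \<Longrightarrow> norm x \<le> B" using assms(3) by (auto simp: bounded_iff)
    then show ?thesis unfolding set_integrable_def
      using fin by (intro integrableI_bounded_set_indicator[of H _ _ B]) auto
  qed
  ultimately show ?thesis by (intro set_integrable_mult_right set_integral_diff)
qed

lemma set_integral_diff_Avg:
  assumes "0 \<le> s" "s \<le> 1" "s_set s H" "bounded H"
  shows "(LINT x:H|hausdorff_measure s. \<sigma> * (x - c)) =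
    \<sigma> * (Avg H - c) * measure (hausdorff_measure s) H"
proof -
  let ?M = "hausdorff_measure s"
  have fin: "0 < emeasure ?M H" "emeasure ?M H < \<infinity>" and [measurable]: "H \<in> sets ?M"
    using assms by (auto simp: s_set_def)
  \<comment> \<open>The division in \<open>Avg\<close> is therefore genuine and can be
    undone.\<close>
  then have "measure ?M H \<noteq> 0"
    by (auto simp: measure_def enn2real_eq_0_iff)
  then have "(LINT x:H|?M. x) = Avg H * measure ?M H"
    using set_dim_eq[of s H] assms by (simp add: Avg_def)
  moreover have "set_integrable ?M H (\<lambda>x. x)"
    using s_set_integrable[of s H 1 0] assms by simp
  moreover have "set_integrable ?M H (\<lambda>x. c)"
    unfolding set_integrable_def using fin by simp
  ultimately have "(LINT x:H|?M. x - c) = Avg H * measure ?M H - c * measure ?M H"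
    using fin by (simp add: set_integral_diff set_integral_const less_top)
  then show ?thesis by (simp add: left_diff_distrib)
qed

section \<open>The separation argument\<close>

text \<open>Individual points of \<open>H\<close> may lie on either side of
  \<open>Avg (H \<union> L)\<close>. For equal dimensions only the integral over \<open>H\<close>
  matters; for \<open>s < t\<close> these points form a null set.\<close>

lemma Avg_Un_not_separated:
  assumes H: "0 \<le> s" "s \<le> 1" "s_set s H"
    and K: "0 \<le> t" "t \<le> 1" "s_set t (H \<union> L)" "bounded (H \<union> L)"
    and pos: "0 < \<sigma> * (Avg H - Avg (H \<union> L))" "\<And>y. y \<in> L \<Longrightarrow> 0 < \<sigma> * (y - Avg (H \<union> L))"
  shows False
proof -
  let ?M = "hausdorff_measure t" and ?K = "H \<union> L"
  define f where "f = (\<lambda>x. \<sigma> * (x - Avg (H \<union> L)))"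
  have sets: "?K \<in> sets ?M" and Kpos: "emeasure ?M ?K \<noteq> 0"
    using K by (auto simp: s_set_def)
  have int: "set_integrable ?M ?K f"
    unfolding f_def using K by (intro s_set_integrable)
  have zero: "(LINT x:?K|?M. f x) = 0"
    unfolding f_def using K by (subst set_integral_diff_Avg) auto
  have H_bd: "bounded H" using K by auto
  consider "s = t" | "s < t" | "t < s" by linarith
  then show False
  proof cases
    case 1
    then have Hs: "H \<in> sets ?M" "0 < emeasure ?M H" "emeasure ?M H < \<infinity>"
      using H by (auto simp: s_set_def)
    have "(LINT x:H|?M. f x) = \<sigma> * (Avg H - Avg ?K) * measure ?M H"
      unfolding f_def using set_integral_diff_Avg[OF H H_bd] 1 by simp
    moreover have "0 < measure ?M H"
      using Hs by (simp add: measure_def enn2real_positive_iff)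
    ultimately have "0 < (LINT x:H|?M. f x)" using pos by simp
    \<comment> \<open>The set \<open>?K - H\<close> is contained in \<open>L\<close>, where
      \<open>f\<close> is positive.\<close>
    moreover have "0 \<le> (LINT x:?K - H|?M. f x)"
      unfolding set_lebesgue_integral_def f_def
      using pos by (intro integral_nonneg_AE AE_I2) (auto simp: indicator_def less_imp_le)
    moreover have "(LINT x:H \<union> (?K - H)|?M. f x) = (LINT x:H|?M. f x) + (LINT x:?K - H|?M. f x)"
      using Hs sets by (intro set_integral_Un set_integrable_subset[OF int]) auto
    ultimately show False using zero by simp
  next
    case 2
    then have "H \<in> null_sets ?M"
      using H s_set_outer by (intro null_sets_hausdorff_measureI hausdorff_outer_eq_0) auto
    then have notH: "AE x in ?M. x \<notin> H" by (rule AE_not_in)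
    have "AE x in ?M. indicator ?K x *\<^sub>R f x = 0"
    proof (subst integral_nonneg_eq_0_iff_AE[symmetric])
      show "integrable ?M (\<lambda>x. indicator ?K x *\<^sub>R f x)"
        using int by (simp add: set_integrable_def)
      show "AE x in ?M. 0 \<le> indicator ?K x *\<^sub>R f x"
        using notH by eventually_elim (use pos in \<open>auto simp: f_def indicator_def less_imp_le\<close>)
      show "(LINT x|?M. indicator ?K x *\<^sub>R f x) = 0"
        using zero by (simp add: set_lebesgue_integral_def)
    qed
    \<comment> \<open>Outside \<open>H\<close>, a point of \<open>?K\<close> lies in
      \<open>L\<close>, where \<open>f\<close> is strictly positive and so cannot vanish.\<close>
    with notH have "AE x in ?M. x \<notin> ?K"
      by eventually_elim (use pos in \<open>fastforce simp: f_def indicator_def\<close>)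
    then have "emeasure ?M ?K = 0"
      using AE_iff_null_sets[OF sets] by blast
    then show False using Kpos by simp
  next
    case 3
    then have "hausdorff_outer s ?K = 0"
      using K s_set_outer by (intro hausdorff_outer_eq_0) auto
    moreover have "hausdorff_outer s H \<le> hausdorff_outer s ?K"
      by (intro hausdorff_outer_mono) auto
    ultimately show False using s_set_outer[OF H(3)] by simp
  qed
qed

theorem theorem4p8:
  fixes I H L :: "real set"
  assumes "closed I" and "is_interval I"
    and "H \<in> Dom_Avg" and "Avg H \<in> I"
    and "L \<subseteq> I" and "H \<union> L \<in> Dom_Avg"
  shows "Avg (H \<union> L) \<in> I"
proof (rule ccontr)
  let ?c = "Avg (H \<union> L)"
  assume c: "?c \<notin> I"
  obtain s where s: "0 \<le> s" "s \<le> 1" "s_set s H"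
    using assms(3) by (auto simp: Dom_Avg_def)
  obtain t where t: "0 \<le> t" "t \<le> 1" "s_set t (H \<union> L)" "bounded (H \<union> L)"
    using assms(6) by (auto simp: Dom_Avg_def)
  have "(\<forall>y\<in>I. ?c < y) \<or> (\<forall>y\<in>I. y < ?c)"
    using assms(2) c unfolding is_interval_1 by (meson not_less)
  then show False
  proof
    assume "\<forall>y\<in>I. ?c < y"
    then show False
      using assms(4,5) by (intro Avg_Un_not_separated[OF s t, where \<sigma> = 1]) auto
  next
    assume "\<forall>y\<in>I. y < ?c"
    then show False
      using assms(4,5) by (intro Avg_Un_not_separated[OF s t, where \<sigma> = "-1"]) auto
  qed
qed

end
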